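(* Let $\lambda/\mu$ and $\nu/\rho$ be skew shapes, where $\lambda,\mu,\nu,\rho$ are written as sequences of the same length $\ell$ (partitions padded with zeros). Let $T$ be a $(\lambda/\mu)\circledast(\nu/\rho)$-peelable tableau and let $T'=\operatorname{BK}_1\circ\operatorname{BK}_3\circ\cdots\circ\operatorname{BK}_{2\ell-1}(T)$. Then $T'$ is a $(\nu/\rho)\circledast(\lambda/\mu)$-peelable tableau, and $T$ and $T'$ have the same shape.
   Context: Young diagrams are in English convention: $(i,j)$ is row $i$ (numbered top to bottom), column $j$. For skew shapes $\alpha/\beta$ and $\gamma/\delta$, the shuffle diagram $D$ of shape $(\alpha/\beta)\circledast(\gamma/\delta)$ has a square at $(2i-1,2j-1)$ for each square $(i,j)$ of $\alpha/\beta$ and a square at $(2i,2j)$ for each square $(i,j)$ of $\gamma/\delta$. For $i\ge1$ let $a_i$ be the number of columns of $D$ containing a square in row $i$ and a square in row $i+2$. A $D$-peelable (also called $(\alpha/\beta)\circledast(\gamma/\delta)$-peelable) tableau is a semistandard Young tableau $T$ of some partition shape whose content is $(\alpha_1-\beta_1,\gamma_1-\delta_1,\alpha_2-\beta_2,\gamma_2-\delta_2,\ldots)$ (number of entries $r$ equals number of squares in row $r$ of $D$), such that for every $i\ge 1$ there are at least $a_i$ pairwise disjoint pairs (square containing $i$, square containing $i+2$) with the $i$-square Northeast of the $(i+2)$-square (in a row weakly above and a column weakly to the right). The Bender--Knuth involution $\operatorname{BK}_i$ on semistandard Young tableaux of a fixed shape is defined as follows: let $S$ be the set of squares of $T$ containing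 $i$ or $i+1$; in each row of $S$ there are, from left to right, $a$ entries $i$ lying directly above an $i+1$, then $b$ entries $i$ alone in their column (within $S$), then $c$ entries $i+1$ alone in their column, then $d$ entries $i+1$ lying directly below an $i$; replace, in every row, the $b+c$ free entries by $c$ entries $i$ followed by $b$ entries $i+1$, leaving everything else unchanged. This produces a semistandard tableau $\operatorname{BK}_i(T)$ of the same shape with the numbers of $i$'s and $(i+1)$'s exchanged. *)

theory Defs
  imports Main
begin

text \<open>
  Squares are pairs \<open>(row, column)\<close> of natural numbers, both counted from 1; rows are numbered from
  top to bottom and columns from left to right. Partitions are weakly decreasing lists, possibly
  padded with zeros.
\<close>

definition is_partition :: "nat list \<Rightarrow> bool" where
  "is_partition \<alpha> \<longleftrightarrow> sorted_wrt (\<ge>) \<alpha>"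

definition young_diagram :: "nat list \<Rightarrow> (nat \<times> nat) set" where
  "young_diagram \<alpha> = {(i, j). 1 \<le> i \<and> i \<le> length \<alpha> \<and> 1 \<le> j \<and> j \<le> \<alpha> ! (i - 1)}"

text \<open>\<open>list_all2\<close> forces the two partitions to be padded to the same length.\<close>

definition is_skew_shape :: "nat list \<Rightarrow> nat list \<Rightarrow> bool" where
  "is_skew_shape \<alpha> \<beta> \<longleftrightarrow> is_partition \<alpha> \<and> is_partition \<beta> \<and> list_all2 (\<le>) \<beta> \<alpha>"

definition skew_diagram :: "nat list \<Rightarrow> nat list \<Rightarrow> (nat \<times> nat) set" where
  "skew_diagram \<alpha> \<beta> = young_diagram \<alpha> - young_diagram \<beta>"

text \<open>The shuffle diagram of shape \<open>(\<alpha>/\<beta>) \<circledast> (\<gamma>/\<delta>)\<close>.\<close>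

definition shuffle_diagram ::
    "nat list \<Rightarrow> nat list \<Rightarrow> nat list \<Rightarrow> nat list \<Rightarrow> (nat \<times> nat) set" where
  "shuffle_diagram \<alpha> \<beta> \<gamma> \<delta> =
     {(2 * i - 1, 2 * j - 1) | i j. (i, j) \<in> skew_diagram \<alpha> \<beta>} \<union>
     {(2 * i, 2 * j) | i j. (i, j) \<in> skew_diagram \<gamma> \<delta>}"

text \<open>
  A filling of a set of squares is a partial map whose domain is that set. The shape of a tableau is
  recorded as its set of squares, which determines the partition up to trailing zeros.
\<close>

type_synonym tableau = "nat \<times> nat \<rightharpoonup> nat"

definition shape :: "tableau \<Rightarrow> (nat \<times> nat) set" where
  "shape T = dom T"

definition semistandard :: "tableau \<Rightarrow> bool" where
  "semistandard T \<longleftrightarrow>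
     (\<exists>\<kappa>. is_partition \<kappa> \<and> shape T = young_diagram \<kappa>) \<and>
     (\<forall>s x. T s = Some x \<longrightarrow> 1 \<le> x) \<and>
     (\<forall>i j j' x y. j < j' \<and> T (i, j) = Some x \<and> T (i, j') = Some y \<longrightarrow> x \<le> y) \<and>
     (\<forall>i i' j x y. i < i' \<and> T (i, j) = Some x \<and> T (i', j) = Some y \<longrightarrow> x < y)"

definition northeast_of :: "nat \<times> nat \<Rightarrow> nat \<times> nat \<Rightarrow> bool" where
  "northeast_of p q \<longleftrightarrow> fst p \<le> fst q \<and> snd p \<ge> snd q"

text \<open>The number \<open>a\<^sub>i\<close> of columns of \<open>D\<close> with a square in row \<open>i\<close> and a square in row \<open>i + 2\<close>.\<close>

definition col_overlap :: "(nat \<times> nat) set \<Rightarrow> nat \<Rightarrow> nat" where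
  "col_overlap D i = card {c. (i, c) \<in> D \<and> (i + 2, c) \<in> D}"

definition peelable :: "(nat \<times> nat) set \<Rightarrow> tableau \<Rightarrow> bool" where
  "peelable D T \<longleftrightarrow>
     semistandard T \<and>
     (\<forall>r\<ge>1. card {s. T s = Some r} = card {c. (r, c) \<in> D}) \<and>
     (\<forall>i\<ge>1. \<exists>P.
        (\<forall>(p, q)\<in>P. T p = Some i \<and> T q = Some (i + 2) \<and> northeast_of p q) \<and>
        pairwise (\<lambda>(p, q) (p', q'). {p, q} \<inter> {p', q'} = {}) P \<and>
        card P \<ge> col_overlap D i)"

text \<open>
  The columns whose square in row \<open>r\<close> contains \<open>i\<close> or \<open>i + 1\<close> and is the only square of its column
  containing one of these two entries.
\<close>

definition free_cols :: "nat \<Rightarrow> tableau \<Rightarrow> nat \<Rightarrow> nat set" where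
  "free_cols i T r =
     {j. T (r, j) \<in> {Some i, Some (i + 1)} \<and>
         (\<forall>r'. r' \<noteq> r \<longrightarrow> T (r', j) \<notin> {Some i, Some (i + 1)})}"

text \<open>
  The Bender--Knuth involution: if the free entries of row \<open>r\<close> are \<open>b\<close> entries \<open>i\<close> and \<open>c\<close> entries
  \<open>i + 1\<close>, the first \<open>c\<close> free squares from the left receive \<open>i\<close> and the other \<open>b\<close> receive \<open>i + 1\<close>.
\<close>

definition BK :: "nat \<Rightarrow> tableau \<Rightarrow> tableau" where
  "BK i T = (\<lambda>(r, j).
     if j \<in> free_cols i T r then
       (let c = card {k \<in> free_cols i T r. T (r, k) = Some (i + 1)}
        in if card {k \<in> free_cols i T r. k < j} < c then Some i else Some (i + 1))
     else T (r, j))"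

text \<open>The composite \<open>BK\<^sub>1 \<circ> BK\<^sub>3 \<circ> \<dots> \<circ> BK\<^bsub>2l-1\<^esub>\<close>; the last factor acts first.\<close>

definition BK_odd :: "nat \<Rightarrow> tableau \<Rightarrow> tableau" where
  "BK_odd l T = foldr BK (map (\<lambda>k. 2 * k - 1) [1..<l + 1]) T"

end

theory Submission
  imports Defs
begin

text \<open>
  In a semistandard tableau an entry \<open>i\<close> is Northeast of an entry \<open>i + 2\<close> iff its column is weakly to
  the right. By Hall's theorem on a chain, \<open>a\<close> disjoint Northeast pairs exist iff for every \<open>c\<close>
  the entries \<open>i\<close> in columns \<open>\<ge> c\<close> together with the entries \<open>i + 2\<close> in columns \<open>< c\<close> number at
  least \<open>a\<close>. The involution \<open>BK\<^sub>i\<close> permutes only free entries, and the free columns of a row form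
  an interval. So the new \<open>(i+1)\<close>'s lie weakly to the right of the old \<open>i\<close>'s, the new \<open>i\<close>'s weakly to
  the left of the old \<open>(i+1)\<close>'s, and the counts agree at every \<open>c\<close> that does not cut such an
  interval. On an interval of free columns for \<open>i + 2\<close> (respectively \<open>i\<close>) of the new tableau, the
  columns containing \<open>i + 1\<close> and those containing \<open>i + 3\<close> (respectively \<open>i\<close> and \<open>i + 2\<close>) are
  comparable by inclusion, so the count is minimised at an end of the interval, and only the \<open>c\<close>
  that do not cut one have to be compared with the old tableau.
\<close>

section \<open>Column sets, cuts and local agreement of tableaux\<close>

definition entry_cols :: "tableau \<Rightarrow> nat \<Rightarrow> nat set" where
  "entry_cols T v = {j. \<exists>r. T (r, j) = Some v}"

text \<open>The size of a vertex cover: a pair \<open>(x, y)\<close> with \<open>y \<le> x\<close>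
  has \<open>x \<ge> c\<close> or \<open>y < c\<close>, so no matching of such pairs exceeds this
  count.\<close>

definition cut_count :: "nat set \<Rightarrow> nat set \<Rightarrow> nat \<Rightarrow> nat" where
  "cut_count A C c = card (A \<inter> {c..}) + card (C \<inter> {..<c})"

text \<open>\<open>c\<close> stands for the gap just left of column \<open>c\<close>; a cut
  separates no two free columns of one row.\<close>

definition is_cut :: "nat \<Rightarrow> tableau \<Rightarrow> nat \<Rightarrow> bool" where
  "is_cut i T c \<longleftrightarrow> (\<forall>r. free_cols i T r \<subseteq> {..<c} \<or> free_cols i T r \<subseteq> {c..})"

text \<open>\<open>BK i\<close> reads and writes only the entries \<open>i\<close> and
  \<open>i + 1\<close>, so agreement on these two isolates one factor of a composite.\<close>

definition same_entries :: "nat \<Rightarrow> tableau \<Rightarrow> tableau \<Rightarrow> bool" where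
  "same_entries i T S \<longleftrightarrow> (\<forall>s. \<forall>v\<in>{i, i + 1}. T s = Some v \<longleftrightarrow> S s = Some v)"

section \<open>Matchings of finite sets of numbers\<close>

lemma card_less_nth_sorted_list_of_set:
  fixes A :: "nat set"
  assumes "finite A" "m < card A"
  shows "card (A \<inter> {..<sorted_list_of_set A ! m}) = m"
proof -
  let ?xs = "sorted_list_of_set A"
  have len: "length ?xs = card A" and sw: "sorted_wrt (<) ?xs" and st: "set ?xs = A"
    using assms by auto
  have lt: "?xs ! i < ?xs ! j" if "i < j" "j < card A" for i j
    using sorted_wrt_nth_less[OF sw that(1)] that(2) len by auto
  have "A \<inter> {..<?xs ! m} = (\<lambda>i. ?xs ! i) ` {..<m}"
  proof (intro set_eqI iffI)
    fix x assume x: "x \<in> A \<inter> {..<?xs ! m}"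
    then obtain i where i: "i < card A" "x = ?xs ! i"
      using st len by (metis IntD1 in_set_conv_nth)
    have "i < m"
    proof (rule ccontr)
      assume "\<not> i < m"
      then have "?xs ! m \<le> ?xs ! i" using lt[of m i] i(1) by (cases "m = i") auto
      then show False using x i by auto
    qed
    then show "x \<in> (\<lambda>i. ?xs ! i) ` {..<m}" using i by auto
  next
    fix x assume "x \<in> (\<lambda>i. ?xs ! i) ` {..<m}"
    then obtain i where "i < m" "x = ?xs ! i" by auto
    then show "x \<in> A \<inter> {..<?xs ! m}"
      using lt[of i m] assms st len by (metis IntI lessThan_iff less_trans nth_mem)
  qed
  moreover have "inj_on (\<lambda>i. ?xs ! i) {..<m}"
    using assms by (auto simp: inj_on_def nth_eq_iff_index_eq)
  ultimately show ?thesis by (simp add: card_image)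
qed

text \<open>Threshold covers suffice because the admissible partners of \<open>x\<close> form an
  initial segment of \<open>C\<close>, and these segments grow with \<open>x\<close>.\<close>

lemma matching_of_cut_count:
  fixes A C :: "nat set"
  assumes fin: "finite A" "finite C" and cc: "\<And>c. a \<le> cut_count A C c"
  shows "\<exists>Q \<subseteq> A \<times> C. card Q = a \<and> inj_on fst Q \<and> inj_on snd Q \<and> (\<forall>(x, y)\<in>Q. y \<le> x)"
proof -
  let ?xs = "sorted_list_of_set A" and ?ys = "sorted_list_of_set C"
  \<comment> \<open>The cut at 0 counts all of \<open>A\<close>, and a cut beyond every element
    counts all of \<open>C\<close>, so both sets have at least \<open>a\<close> elements.\<close>
  have aA: "a \<le> card A" using cc[of 0] by (simp add: cut_count_def)
  obtain M where M: "\<And>x. x \<in> A \<union> C \<Longrightarrow> x < M"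
    using fin by (metis finite_UnI finite_nat_set_iff_bounded)
  then have "A \<inter> {M..} = {}" "C \<inter> {..<M} = C" by (fastforce simp: disjoint_iff)+
  then have aC: "a \<le> card C" using cc[of M] by (simp add: cut_count_def)
  \<comment> \<open>Match the \<open>a\<close> largest elements of \<open>A\<close> with the \<open>a\<close> smallest of \<open>C\<close> in increasing order.\<close>
  define x where "x m = ?xs ! (card A - a + m)" for m
  define y where "y m = ?ys ! m" for m
  have xA: "x m \<in> A" if "m < a" for m
    using that aA fin unfolding x_def
    by (metis Nat.le_diff_conv2 add.commute add_less_cancel_left le_add_diff_inverse2
        length_sorted_list_of_set nth_mem set_sorted_list_of_set)
  have yC: "y m \<in> C" if "m < a" for m
    using that aC fin unfolding y_def
    by (metis length_sorted_list_of_set less_le_trans nth_mem set_sorted_list_of_set)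
  have injx: "inj_on x {..<a}"
    using aA fin unfolding x_def by (auto simp: inj_on_def nth_eq_iff_index_eq)
  have injy: "inj_on y {..<a}"
    using aC fin unfolding y_def by (auto simp: inj_on_def nth_eq_iff_index_eq)
  have le: "y m \<le> x m" if m: "m < a" for m
  proof (rule ccontr)
    \<comment> \<open>The cut at \<open>y m\<close> would keep at most the \<open>a - m - 1\<close>
      elements of \<open>A\<close> above \<open>x m\<close> and exactly \<open>m\<close> elements of
      \<open>C\<close>: one too few.\<close>
    assume "\<not> y m \<le> x m"
    then have sub: "A \<inter> {y m..} \<subseteq> A - (A \<inter> {..<x m}) - {x m}" by auto
    have "card (A \<inter> {..<x m}) = card A - a + m"
      unfolding x_def using fin aA m by (intro card_less_nth_sorted_list_of_set) auto
    then have "card (A - (A \<inter> {..<x m}) - {x m}) = card A - (card A - a + m) - 1"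
      using xA[OF m] fin by (simp add: card_Diff_subset)
    then have "card (A \<inter> {y m..}) \<le> a - m - 1"
      using card_mono[OF _ sub] fin aA by simp
    moreover have "card (C \<inter> {..<y m}) = m"
      unfolding y_def using fin aC m by (intro card_less_nth_sorted_list_of_set) auto
    ultimately show False using cc[of "y m"] m by (simp add: cut_count_def)
  qed
  let ?Q = "(\<lambda>m. (x m, y m)) ` {..<a}"
  have "inj_on (\<lambda>m. (x m, y m)) {..<a}" using injx by (auto simp: inj_on_def)
  then have "card ?Q = a" by (simp add: card_image)
  moreover have "inj_on fst ?Q" "inj_on snd ?Q"
    using injx injy by (auto simp: inj_on_def)
  ultimately show ?thesis using xA yC le by (intro exI[of _ ?Q]) auto
qed

text \<open>Moving the cut from \<open>s\<close> to \<open>c\<close> drops the elements of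
  \<open>A\<close> in \<open>{s..<c}\<close> and gains those of \<open>C\<close>; moving it on to
  \<open>e + 1\<close> does the same on \<open>{c..e}\<close>. Each inclusion fixes the sign of one
  of these changes.\<close>

lemma cut_count_comparable:
  assumes fin: "finite A" "finite C" and c: "s \<le> c" "c \<le> e + 1"
    and comp: "A \<inter> {s..e} \<subseteq> C \<or> C \<inter> {s..e} \<subseteq> A"
  shows "cut_count A C s \<le> cut_count A C c \<or> cut_count A C (e + 1) \<le> cut_count A C c"
  using comp
proof
  assume sub: "A \<inter> {s..e} \<subseteq> C"
  have "card (A \<inter> {s..}) = card (A \<inter> {s..<c}) + card (A \<inter> {c..})"
    using fin c by (subst card_Un_disjoint[symmetric]) (auto intro!: arg_cong[of _ _ card])
  moreover have "card (C \<inter> {..<c}) = card (C \<inter> {..<s}) + card (C \<inter> {s..<c})"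
    using fin c by (subst card_Un_disjoint[symmetric]) (auto intro!: arg_cong[of _ _ card])
  moreover have "card (A \<inter> {s..<c}) \<le> card (C \<inter> {s..<c})"
    using sub fin c by (intro card_mono) auto
  ultimately show ?thesis by (simp add: cut_count_def)
next
  assume sub: "C \<inter> {s..e} \<subseteq> A"
  have "card (A \<inter> {c..}) = card (A \<inter> {c..e}) + card (A \<inter> {e + 1..})"
    using fin c by (subst card_Un_disjoint[symmetric]) (auto intro!: arg_cong[of _ _ card])
  moreover have "card (C \<inter> {..<e + 1}) = card (C \<inter> {..<c}) + card (C \<inter> {c..e})"
    using fin c by (subst card_Un_disjoint[symmetric]) (auto intro!: arg_cong[of _ _ card])
  moreover have "card (C \<inter> {c..e}) \<le> card (A \<inter> {c..e})"
    using sub fin c by (intro card_mono) auto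
  ultimately show ?thesis by (simp add: cut_count_def)
qed

section \<open>Ranks and extremal subsets of a finite set\<close>

text \<open>The rank in \<open>F\<close> is a bijection onto \<open>{..<card F}\<close>. This counts
  the free squares that \<open>BK\<close> fills with the smaller entry.\<close>

lemma card_rank_less:
  fixes F :: "nat set"
  assumes fin: "finite F" and m: "m \<le> card F"
  shows "card {j \<in> F. card {k \<in> F. k < j} < m} = m"
proof -
  let ?rk = "\<lambda>j. card {k \<in> F. k < j}"
  have "?rk j < ?rk j'" if "j \<in> F" "j < j'" for j j'
    using that fin by (intro psubset_card_mono) auto
  then have inj: "inj_on ?rk F" by (intro linorder_inj_onI') force
  have "?rk j < card F" if "j \<in> F" for j
    using that fin by (intro psubset_card_mono) auto
  then have "?rk ` F \<subseteq> {..<card F}" by auto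
  then have im: "?rk ` F = {..<card F}"
    using inj by (intro card_subset_eq) (auto simp: card_image)
  have "?rk ` {j \<in> F. ?rk j < m} = {..<m}"
  proof -
    have "?rk ` {j \<in> F. ?rk j < m} = ?rk ` F \<inter> {..<m}" by auto
    then show ?thesis using im m by auto
  qed
  moreover have "inj_on ?rk {j \<in> F. ?rk j < m}" using inj by (rule inj_on_subset) auto
  ultimately show ?thesis using card_image by fastforce
qed

text \<open>Either \<open>U\<close> contains all of \<open>F\<close> from \<open>c\<close> on, or it
  misses some \<open>f\<close> there and upward closure forces all of \<open>U\<close> beyond
  \<open>f\<close>.\<close>

lemma card_upper_set_ge:
  fixes U V F :: "nat set"
  assumes fin: "finite F" and sub: "U \<subseteq> F" "V \<subseteq> F" and card: "card U = card V"
    and up: "\<And>x y. x \<in> U \<Longrightarrow> y \<in> F \<Longrightarrow> x \<le> y \<Longrightarrow> y \<in> U"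
  shows "card (V \<inter> {c..}) \<le> card (U \<inter> {c..})"
proof (cases "F \<inter> {c..} \<subseteq> U")
  case True
  then show ?thesis using fin sub by (intro card_mono) (auto intro: finite_subset)
next
  case False
  then obtain f where f: "f \<in> F" "c \<le> f" "f \<notin> U" by auto
  have "U \<subseteq> {c..}"
  proof
    fix x assume x: "x \<in> U"
    then have "f < x" using up[OF x f(1)] f(3) by force
    then show "x \<in> {c..}" using f(2) by simp
  qed
  then have "card (U \<inter> {c..}) = card V" using card by (simp add: Int_absorb2)
  then show ?thesis using fin sub by (simp add: card_mono finite_subset)
qed

lemma card_lower_set_ge:
  fixes U V F :: "nat set"
  assumes fin: "finite F" and sub: "U \<subseteq> F" "V \<subseteq> F" and card: "card U = card V"
    and low: "\<And>x y. x \<in> U \<Longrightarrow> y \<in> F \<Longrightarrow> y \<le> x \<Longrightarrow> y \<in> U"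
  shows "card (V \<inter> {..<c}) \<le> card (U \<inter> {..<c})"
proof (cases "F \<inter> {..<c} \<subseteq> U")
  case True
  then show ?thesis using fin sub by (intro card_mono) (auto intro: finite_subset)
next
  case False
  then obtain f where f: "f \<in> F" "f < c" "f \<notin> U" by auto
  have "U \<subseteq> {..<c}"
  proof
    fix x assume x: "x \<in> U"
    then have "x < f" using low[OF x f(1)] f(3) by force
    then show "x \<in> {..<c}" using f(2) by simp
  qed
  then have "card (U \<inter> {..<c}) = card V" using card by (simp add: Int_absorb2)
  then show ?thesis using fin sub by (simp add: card_mono finite_subset)
qed

lemma card_split_family:
  assumes fin: "finite C" "finite R" and disj: "\<And>r r'. r \<noteq> r' \<Longrightarrow> F r \<inter> F r' = {}"
    and R: "\<And>r. r \<notin> R \<Longrightarrow> F r = {}"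
  shows "card C = card (C - (\<Union>r. F r)) + (\<Sum>r\<in>R. card (C \<inter> F r))"
proof -
  have "C = (C - (\<Union>r. F r)) \<union> (\<Union>r\<in>R. C \<inter> F r)" using R by blast
  then have "card C = card ((C - (\<Union>r. F r)) \<union> (\<Union>r\<in>R. C \<inter> F r))" by (rule arg_cong)
  also have "\<dots> = card (C - (\<Union>r. F r)) + card (\<Union>r\<in>R. C \<inter> F r)"
    using fin by (intro card_Un_disjoint) auto
  also have "card (\<Union>r\<in>R. C \<inter> F r) = (\<Sum>r\<in>R. card (C \<inter> F r))"
    using fin disj by (intro card_UN_disjoint) blast+
  finally show ?thesis .
qed

section \<open>Semistandard tableaux\<close>

lemma finite_young_diagram: "finite (young_diagram \<kappa>)"
proof -
  have "young_diagram \<kappa> \<subseteq> (SIGMA i:{1..length \<kappa>}. {1..\<kappa> ! (i - 1)})"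
    by (auto simp: young_diagram_def)
  then show ?thesis by (rule finite_subset) auto
qed

lemma semistandard_finite:
  assumes "semistandard T"
  shows "finite (dom T)"
  using assms finite_young_diagram by (auto simp: semistandard_def shape_def)

lemma finite_entry_cols:
  assumes "semistandard T"
  shows "finite (entry_cols T v)"
proof -
  have "entry_cols T v \<subseteq> snd ` dom T" by (force simp: entry_cols_def)
  then show ?thesis using semistandard_finite[OF assms] finite_surj by blast
qed

lemma semistandard_row:
  assumes "semistandard T" "T (r, j) = Some x" "T (r, j') = Some y" "j \<le> j'"
  shows "x \<le> y"
  using assms unfolding semistandard_def by (metis le_neq_implies_less option.inject order_refl)

lemma semistandard_col:
  assumes "semistandard T" "T (r, j) = Some x" "T (r', j) = Some y" "r < r'"
  shows "x < y"
  using assms unfolding semistandard_def by metis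

lemma semistandard_col_unique:
  assumes "semistandard T" "T (r, j) = Some x" "T (r', j) = Some x"
  shows "r = r'"
  using semistandard_col[OF assms] semistandard_col[OF assms(1,3,2)] by (meson linorder_neqE_nat less_irrefl)

lemma semistandard_dom_down:
  assumes T: "semistandard T" and "T (r, j) = Some x" "1 \<le> r'" "r' \<le> r" "1 \<le> j'" "j' \<le> j"
  shows "\<exists>y. T (r', j') = Some y"
proof -
  obtain \<kappa> where \<kappa>: "is_partition \<kappa>" "dom T = young_diagram \<kappa>"
    using T by (auto simp: semistandard_def shape_def)
  have "(r, j) \<in> young_diagram \<kappa>" using assms(2) \<kappa>(2) by auto
  then have r: "r \<le> length \<kappa>" "j \<le> \<kappa> ! (r - 1)" by (auto simp: young_diagram_def)
  have "\<kappa> ! (r - 1) \<le> \<kappa> ! (r' - 1)"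
  proof (cases "r = r'")
    case False
    then show ?thesis
      using \<kappa>(1) assms(3,4) r(1) unfolding is_partition_def
      by (auto simp: sorted_wrt_iff_nth_less)
  qed simp
  then have "(r', j') \<in> young_diagram \<kappa>"
    using assms r by (auto simp: young_diagram_def)
  then show ?thesis using \<kappa>(2) by auto
qed

lemma semistandard_pos:
  assumes "semistandard T" "T (r, j) = Some x"
  shows "1 \<le> r" "1 \<le> j" "1 \<le> x"
proof -
  have "(r, j) \<in> dom T" using assms(2) by auto
  then show "1 \<le> r" "1 \<le> j"
    using assms(1) by (auto simp: semistandard_def shape_def young_diagram_def)
  show "1 \<le> x" using assms by (auto simp: semistandard_def)
qed

text \<open>Both other corners lie weakly Northwest of the lower right square, hence in the shape.
  The contradictions about free columns below pass through such a rectangle.\<close>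

lemma semistandard_rectangle:
  assumes T: "semistandard T" and x: "T (r, j) = Some x" and y: "T (r', j') = Some y"
    and le: "r \<le> r'" "j \<le> j'"
  obtains z w where "T (r, j') = Some z" "T (r', j) = Some w" "x \<le> z" "w \<le> y"
    "r < r' \<Longrightarrow> z < y" "r < r' \<Longrightarrow> x < w" "z \<le> y"
proof -
  obtain z where z: "T (r, j') = Some z"
    using semistandard_dom_down[OF T y] semistandard_pos[OF T x] semistandard_pos[OF T y] le by blast
  obtain w where w: "T (r', j) = Some w"
    using semistandard_dom_down[OF T y] semistandard_pos[OF T x] semistandard_pos[OF T y] le by blast
  have "z \<le> y" using semistandard_col[OF T z y] y z le
    by (metis le_neq_implies_less less_imp_le option.inject order_refl)
  then show ?thesis
    using that[OF z w] semistandard_row[OF T x z] semistandard_row[OF T w y]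
      semistandard_col[OF T z y] semistandard_col[OF T x w] le by blast
qed

lemma card_entries:
  assumes "semistandard T"
  shows "card {s. T s = Some v} = card (entry_cols T v)"
proof -
  have "inj_on snd {s. T s = Some v}"
    using semistandard_col_unique[OF assms] by (auto simp: inj_on_def)
  moreover have "snd ` {s. T s = Some v} = entry_cols T v"
    by (force simp: entry_cols_def)
  ultimately show ?thesis by (metis card_image)
qed

section \<open>Northeast matchings as matchings of columns\<close>

text \<open>The matching clause of \<open>peelable\<close> for one \<open>i\<close>, with the number
  of pairs as a parameter.\<close>

definition has_matching :: "tableau \<Rightarrow> nat \<Rightarrow> nat \<Rightarrow> bool" where
  "has_matching T i a \<longleftrightarrow>
     (\<exists>P. (\<forall>(p, q)\<in>P. T p = Some i \<and> T q = Some (i + 2) \<and> northeast_of p q) \<and>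
        pairwise (\<lambda>(p, q) (p', q'). {p, q} \<inter> {p', q'} = {}) P \<and> card P \<ge> a)"

lemma has_matching_imp_cut_count:
  assumes T: "semistandard T" and M: "has_matching T i a"
  shows "a \<le> cut_count (entry_cols T i) (entry_cols T (i + 2)) c"
proof -
  obtain P where P: "\<And>p q. (p, q) \<in> P \<Longrightarrow> T p = Some i \<and> T q = Some (i + 2) \<and> northeast_of p q"
    and pw: "pairwise (\<lambda>(p, q) (p', q'). {p, q} \<inter> {p', q'} = {}) P" and card: "a \<le> card P"
    using M unfolding has_matching_def by fast
  let ?A = "entry_cols T i \<inter> {c..}" and ?C = "entry_cols T (i + 2) \<inter> {..<c}"
  \<comment> \<open>Each pair is charged to its \<open>i\<close> if that stands in column
    \<open>c\<close> or later, otherwise to its \<open>i + 2\<close>, which is then left of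
    \<open>c\<close>. The sum type keeps the two kinds apart, as one column may hold both
    entries.\<close>
  define f :: "(nat \<times> nat) \<times> (nat \<times> nat) \<Rightarrow> nat + nat" where
    "f = (\<lambda>(p, q). if c \<le> snd p then Inl (snd p) else Inr (snd q))"
  have "f ` P \<subseteq> ?A <+> ?C"
  proof
    fix z assume "z \<in> f ` P"
    then obtain r j r' j' where pq: "((r, j), (r', j')) \<in> P" and z: "z = f ((r, j), (r', j'))"
      by auto
    show "z \<in> ?A <+> ?C"
      using P[OF pq] by (auto simp: z f_def northeast_of_def entry_cols_def)
  qed
  moreover have "inj_on f P"
  proof (rule inj_onI, rule ccontr)
    fix u v assume uv: "u \<in> P" "v \<in> P" "f u = f v" "u \<noteq> v"
    obtain r1 j1 r2 j2 where u: "u = ((r1, j1), (r2, j2))" by (metis surj_pair)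
    obtain r3 j3 r4 j4 where v: "v = ((r3, j3), (r4, j4))" by (metis surj_pair)
    have "(r1, j1) \<noteq> (r3, j3)" "(r2, j2) \<noteq> (r4, j4)"
      using pairwiseD[OF pw uv(1,2,4)] by (auto simp: u v)
    moreover have "T (r1, j1) = Some i" "T (r3, j3) = Some i"
      "T (r2, j2) = Some (i + 2)" "T (r4, j4) = Some (i + 2)"
      using P uv(1,2) by (auto simp: u v)
    ultimately have "j1 \<noteq> j3" "j2 \<noteq> j4"
      using semistandard_col_unique[OF T] by blast+
    then show False using uv(3) by (auto simp: f_def u v split: if_splits)
  qed
  moreover have "finite (?A <+> ?C)" using finite_entry_cols[OF T] by simp
  ultimately have "card P \<le> card (?A <+> ?C)" by (metis card_image card_mono)
  also have "\<dots> = cut_count (entry_cols T i) (entry_cols T (i + 2)) c"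
    using finite_entry_cols[OF T] by (simp add: card_Plus cut_count_def)
  finally show ?thesis using card by simp
qed

lemma cut_count_imp_has_matching:
  assumes T: "semistandard T"
    and cc: "\<And>c. a \<le> cut_count (entry_cols T i) (entry_cols T (i + 2)) c"
  shows "has_matching T i a"
proof -
  obtain Q where Q: "Q \<subseteq> entry_cols T i \<times> entry_cols T (i + 2)" "card Q = a"
    "inj_on fst Q" "inj_on snd Q" "\<And>x y. (x, y) \<in> Q \<Longrightarrow> y \<le> x"
    using matching_of_cut_count[OF finite_entry_cols[OF T] finite_entry_cols[OF T] cc] by fast
  \<comment> \<open>The square of column \<open>j\<close> holding \<open>v\<close>. Only the row is
    chosen, so the second component is \<open>j\<close> in every case.\<close>
  define sq where "sq v j = (SOME r. T (r, j) = Some v, j)" for v j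
  have sq: "T (sq v j) = Some v" if "j \<in> entry_cols T v" for v j
    using that unfolding sq_def entry_cols_def by (auto intro: someI)
  have sqj [simp]: "snd (sq v j) = j" for v j by (simp add: sq_def)
  let ?f = "\<lambda>(x, y). (sq i x, sq (i + 2) y)"
  have T1: "T (sq i x) = Some i" "T (sq (i + 2) y) = Some (i + 2)" if "(x, y) \<in> Q" for x y
    using that Q(1) sq by auto
  have "northeast_of (sq i x) (sq (i + 2) y)" if xy: "(x, y) \<in> Q" for x y
  proof -
    obtain r where r: "sq i x = (r, x)" by (simp add: sq_def)
    obtain r' where r': "sq (i + 2) y = (r', y)" by (simp add: sq_def)
    \<comment> \<open>Otherwise the \<open>i + 2\<close> is strictly above and weakly left of the
      \<open>i\<close>, and the rectangle gives \<open>i + 2 < i\<close>.\<close>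
    have "r \<le> r'"
    proof (rule ccontr)
      assume "\<not> r \<le> r'"
      then show False
        using semistandard_rectangle[OF T, of r' y "i + 2" r x i] T1[OF xy] Q(5)[OF xy] r r'
        by fastforce
    qed
    then show ?thesis using Q(5)[OF xy] unfolding r r' by (simp add: northeast_of_def)
  qed
  moreover have "pairwise (\<lambda>(p, q) (p', q'). {p, q} \<inter> {p', q'} = {}) (?f ` Q)"
  proof (rule pairwise_imageI)
    fix u v assume uv: "u \<in> Q" "v \<in> Q" "u \<noteq> v"
    obtain x y x' y' where u: "u = (x, y)" and v: "v = (x', y')" by (metis surj_pair)
    have "x \<noteq> x'" "y \<noteq> y'"
      using inj_onD[OF Q(3) _ uv(1,2)] inj_onD[OF Q(4) _ uv(1,2)] uv(3) by (simp_all add: u v) blast+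
    then have "sq i x \<noteq> sq i x'" "sq (i + 2) y \<noteq> sq (i + 2) y'" by (metis sqj)+
    moreover have "sq i x \<noteq> sq (i + 2) y'" "sq i x' \<noteq> sq (i + 2) y"
      using T1 uv unfolding u v by (metis add_cancel_right_right option.inject zero_neq_numeral)+
    ultimately show "(case ?f u of (p, q) \<Rightarrow> \<lambda>(p', q'). {p, q} \<inter> {p', q'} = {}) (?f v)"
      by (auto simp: u v)
  qed
  moreover have "inj_on ?f Q"
  proof (rule inj_onI)
    fix u v assume uv: "u \<in> Q" "v \<in> Q" "?f u = ?f v"
    then show "u = v" by (auto split: prod.splits) (metis sqj)+
  qed
  then have "card (?f ` Q) = a" using Q(2) by (simp add: card_image)
  ultimately show ?thesis
    unfolding has_matching_def using T1 by (intro exI[of _ "?f ` Q"]) auto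
qed

section \<open>Free columns\<close>

lemma free_cols_disjoint:
  assumes "j \<in> free_cols i T r" "j \<in> free_cols i T r'"
  shows "r = r'"
  using assms by (auto simp: free_cols_def)

lemma finite_free_cols:
  assumes "semistandard T"
  shows "finite (free_cols i T r)"
proof -
  have "free_cols i T r \<subseteq> snd ` dom T" by (force simp: free_cols_def)
  then show ?thesis using semistandard_finite[OF assms] finite_surj by blast
qed

text \<open>The entry in column \<open>k\<close> is squeezed between two entries from
  \<open>{i, i + 1}\<close>. A second such entry in column \<open>k\<close> would, through a
  rectangle, force a second one into column \<open>j\<close> if it is below row \<open>r\<close>, or
  into column \<open>l\<close> if above.\<close>

lemma free_cols_between:
  assumes T: "semistandard T" and j: "j \<in> free_cols i T r" and l: "l \<in> free_cols i T r"
    and k: "j \<le> k" "k \<le> l"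
  shows "k \<in> free_cols i T r"
proof -
  obtain x where x: "T (r, j) = Some x" "x = i \<or> x = i + 1"
    and x': "\<And>r'. r' \<noteq> r \<Longrightarrow> T (r', j) \<notin> {Some i, Some (i + 1)}"
    using j by (auto simp: free_cols_def)
  obtain y where y: "T (r, l) = Some y" "y = i \<or> y = i + 1"
    and y': "\<And>r'. r' \<noteq> r \<Longrightarrow> T (r', l) \<notin> {Some i, Some (i + 1)}"
    using l by (auto simp: free_cols_def)
  obtain z where z: "T (r, k) = Some z"
    using semistandard_dom_down[OF T y(1)] semistandard_pos[OF T x(1)] k by fastforce
  have "x \<le> z" "z \<le> y" using semistandard_row[OF T] x(1) y(1) z k by blast+
  then have zi: "z = i \<or> z = i + 1" using x(2) y(2) by auto
  have "T (r', k) \<notin> {Some i, Some (i + 1)}" if r': "r' \<noteq> r" for r'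
  proof
    assume "T (r', k) \<in> {Some i, Some (i + 1)}"
    then obtain w where w: "T (r', k) = Some w" "w = i \<or> w = i + 1" by auto
    show False
    proof (cases "r < r'")
      case True
      from semistandard_rectangle[OF T x(1) w(1)] True k
      obtain u where "T (r', j) = Some u" "x < u" "u \<le> w" by (metis less_imp_le)
      then show False using x'[OF r'] x(2) w(2) by auto
    next
      case False
      then have lt: "r' < r" using r' by simp
      from semistandard_rectangle[OF T w(1) y(1)] lt k
      obtain u where "T (r', l) = Some u" "w \<le> u" "u < y" by (metis less_imp_le)
      then show False using y'[OF r'] y(2) w(2) by auto
    qed
  qed
  then show ?thesis using z zi by (auto simp: free_cols_def)
qed

text \<open>A gap that is not a cut lies inside the free interval of some row;
  \<open>cut_count_comparable\<close> moves it to one end without raising the count.\<close>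

lemma cut_of_comparable:
  assumes T: "semistandard T" and fin: "finite A" "finite C"
    and comp: "\<And>r. A \<inter> free_cols i T r \<subseteq> C \<or> C \<inter> free_cols i T r \<subseteq> A"
  shows "\<exists>c'. is_cut i T c' \<and> cut_count A C c' \<le> cut_count A C c"
proof (cases "is_cut i T c")
  case False
  then obtain r j1 j2 where j: "j1 \<in> free_cols i T r" "j2 \<in> free_cols i T r" "\<not> c \<le> j1" "\<not> j2 < c"
    by (auto simp: is_cut_def)
  let ?F = "free_cols i T r"
  define s where "s = Min ?F"
  define e where "e = Max ?F"
  have fF: "finite ?F" by (rule finite_free_cols[OF T])
  have sF: "s \<in> ?F" and eF: "e \<in> ?F"
    using j(1) Min_in[OF fF] Max_in[OF fF] unfolding s_def e_def by blast+
  have b: "s \<le> x \<and> x \<le> e" if "x \<in> ?F" for x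
    unfolding s_def e_def using Min_le[OF fF that] Max_ge[OF fF that] by blast
  have F: "?F = {s..e}"
    using b free_cols_between[OF T sF eF] by (meson atLeastAtMost_iff subsetI subset_antisym)
  \<comment> \<open>An interval of another row crossing this gap would contain column
    \<open>s\<close> by convexity, but a column is free in at most one row; row \<open>r\<close>
    itself starts at \<open>s\<close>. The end \<open>e + 1\<close> is similar.\<close>
  have "is_cut i T s"
    unfolding is_cut_def
  proof (intro allI, rule ccontr)
    fix r' assume "\<not> (free_cols i T r' \<subseteq> {..<s} \<or> free_cols i T r' \<subseteq> {s..})"
    then obtain x y where xy: "x \<in> free_cols i T r'" "y \<in> free_cols i T r'" "s \<le> y" "x < s"
      by (auto simp: not_le not_less subset_iff)
    then have "s \<in> free_cols i T r'" using free_cols_between[OF T, of x i r' y s] by simp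
    then have "r' = r" using sF free_cols_disjoint by blast
    then show False using xy b by fastforce
  qed
  moreover have "is_cut i T (e + 1)"
    unfolding is_cut_def
  proof (intro allI, rule ccontr)
    fix r' assume "\<not> (free_cols i T r' \<subseteq> {..<e + 1} \<or> free_cols i T r' \<subseteq> {e + 1..})"
    then obtain x y where xy: "x \<in> free_cols i T r'" "y \<in> free_cols i T r'" "e < y" "x \<le> e"
      by (auto simp: not_le not_less subset_iff)
    then have "e \<in> free_cols i T r'" using free_cols_between[OF T, of x i r' y e] by simp
    then have "r' = r" using eF free_cols_disjoint by blast
    then show False using xy b by fastforce
  qed
  moreover have "cut_count A C s \<le> cut_count A C c \<or> cut_count A C (e + 1) \<le> cut_count A C c"
    using fin j b[OF j(1)] b[OF j(2)] comp[of r] unfolding F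
    by (intro cut_count_comparable) auto
  ultimately show ?thesis by blast
qed auto

text \<open>If neither inclusion held, some column \<open>j\<close> would have an
  \<open>i + 1\<close> above a free \<open>i + 2\<close>, and some \<open>j'\<close> further right a
  free \<open>i + 3\<close>. The entry of column \<open>j'\<close> in the row of that
  \<open>i + 1\<close> is \<open>i + 1\<close> or \<open>i + 2\<close>: the choice of
  \<open>j'\<close> excludes the first, freeness the second.\<close>

lemma upper_cut:
  assumes T: "semistandard T"
  shows "\<exists>c'. is_cut (i + 2) T c' \<and>
    cut_count (entry_cols T (i + 1)) (entry_cols T (i + 3)) c'
      \<le> cut_count (entry_cols T (i + 1)) (entry_cols T (i + 3)) c"
proof (rule cut_of_comparable[OF T finite_entry_cols[OF T] finite_entry_cols[OF T]], rule ccontr)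
  fix r
  let ?F = "free_cols (i + 2) T r"
  assume "\<not> (entry_cols T (i + 1) \<inter> ?F \<subseteq> entry_cols T (i + 3) \<or>
    entry_cols T (i + 3) \<inter> ?F \<subseteq> entry_cols T (i + 1))"
  then obtain j j' where j: "j \<in> ?F" "j \<in> entry_cols T (i + 1)" "j \<notin> entry_cols T (i + 3)"
    and j': "j' \<in> ?F" "j' \<in> entry_cols T (i + 3)" "j' \<notin> entry_cols T (i + 1)" by blast
  have 1: "T (r, j) = Some (i + 2)"
    using j by (auto simp: free_cols_def entry_cols_def eval_nat_numeral)
  have 2: "T (r, j') = Some (i + 3)"
    using j' by (auto simp: free_cols_def entry_cols_def eval_nat_numeral)
  have jj: "j < j'" using semistandard_row[OF T 2 1] by fastforce
  obtain r0 where r0: "T (r0, j) = Some (i + 1)" using j by (auto simp: entry_cols_def)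
  have lt: "r0 < r" using semistandard_col[OF T 1 r0] 1 r0 by (cases "r = r0") force+
  obtain z where z: "T (r0, j') = Some z" "i + 1 \<le> z" "z < i + 3"
    using semistandard_rectangle[OF T r0 2] lt jj by (metis less_imp_le)
  have "z \<noteq> i + 2" using j'(1) z(1) lt by (auto simp: free_cols_def)
  then show False using z j'(3) by (auto simp: entry_cols_def le_less_Suc_eq eval_nat_numeral less_Suc_eq)
qed

text \<open>The dual configuration: a free \<open>i\<close> in column \<open>j\<close> and, further
  right, a free \<open>i + 1\<close> above an \<open>i + 2\<close>. The corner below the
  \<open>i\<close> is \<open>i + 1\<close> or \<open>i + 2\<close>: freeness excludes the first, the
  choice of \<open>j\<close> the second.\<close>

lemma lower_cut:
  assumes T: "semistandard T"
  shows "\<exists>c'. is_cut i T c' \<and>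
    cut_count (entry_cols T i) (entry_cols T (i + 2)) c'
      \<le> cut_count (entry_cols T i) (entry_cols T (i + 2)) c"
proof (rule cut_of_comparable[OF T finite_entry_cols[OF T] finite_entry_cols[OF T]], rule ccontr)
  fix r
  let ?F = "free_cols i T r"
  assume "\<not> (entry_cols T i \<inter> ?F \<subseteq> entry_cols T (i + 2) \<or>
    entry_cols T (i + 2) \<inter> ?F \<subseteq> entry_cols T i)"
  then obtain j j' where j: "j \<in> ?F" "j \<in> entry_cols T i" "j \<notin> entry_cols T (i + 2)"
    and j': "j' \<in> ?F" "j' \<in> entry_cols T (i + 2)" "j' \<notin> entry_cols T i" by blast
  have 1: "T (r, j) = Some i"
    using j by (auto simp: free_cols_def entry_cols_def)
  have 2: "T (r, j') = Some (i + 1)"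
    using j' by (auto simp: free_cols_def entry_cols_def)
  have jj: "j < j'" using semistandard_row[OF T 2 1] by fastforce
  obtain r0 where r0: "T (r0, j') = Some (i + 2)" using j' by (auto simp: entry_cols_def)
  have lt: "r < r0" using semistandard_col[OF T r0 2] 2 r0 by (cases "r = r0") force+
  obtain w where w: "T (r0, j) = Some w" "i < w" "w \<le> i + 2"
    using semistandard_rectangle[OF T 1 r0] lt jj by (metis less_imp_le)
  have "w \<noteq> i + 1" using j(1) w(1) lt by (auto simp: free_cols_def)
  then have "w = i + 2" using w by simp
  then show False using w(1) j(3) by (auto simp: entry_cols_def)
qed

section \<open>The Bender--Knuth involution\<close>

lemma BK_not_free: "j \<notin> free_cols i T r \<Longrightarrow> BK i T (r, j) = T (r, j)"
  by (simp add: BK_def)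

lemma BK_free:
  assumes "j \<in> free_cols i T r"
  shows "BK i T (r, j) =
    (if card {k \<in> free_cols i T r. k < j} < card {k \<in> free_cols i T r. T (r, k) = Some (i + 1)}
     then Some i else Some (i + 1))"
  using assms by (simp add: BK_def Let_def)

lemma free_colsD: "j \<in> free_cols i T r \<Longrightarrow> T (r, j) = Some i \<or> T (r, j) = Some (i + 1)"
  by (auto simp: free_cols_def)

text \<open>Freeness depends only on this membership, so it survives the involution.\<close>

lemma BK_mem_iff: "BK i T s \<in> {Some i, Some (i + 1)} \<longleftrightarrow> T s \<in> {Some i, Some (i + 1)}"
proof (cases s)
  case (Pair r j)
  then show ?thesis
    by (cases "j \<in> free_cols i T r") (use free_colsD[of j i T r] in \<open>auto simp: BK_free BK_not_free\<close>)
qed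

lemma BK_other: "v \<notin> {i, i + 1} \<Longrightarrow> BK i T s = Some v \<longleftrightarrow> T s = Some v"
proof (cases s)
  case (Pair r j)
  assume "v \<notin> {i, i + 1}"
  with Pair show ?thesis
    by (cases "j \<in> free_cols i T r") (use free_colsD[of j i T r] in \<open>auto simp: BK_free BK_not_free\<close>)
qed

lemma dom_BK: "dom (BK i T) = dom T"
proof (intro set_eqI)
  fix s show "s \<in> dom (BK i T) \<longleftrightarrow> s \<in> dom T"
  proof (cases s)
    case (Pair r j)
    then show ?thesis
      by (cases "j \<in> free_cols i T r")
        (use free_colsD[of j i T r] in \<open>auto simp: BK_free BK_not_free dom_def\<close>)
  qed
qed

lemma free_cols_BK: "free_cols i (BK i T) r = free_cols i T r"
  unfolding free_cols_def BK_mem_iff ..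

lemma BK_cases:
  assumes "BK i T (r, j) = Some x"
  obtains "j \<notin> free_cols i T r" "T (r, j) = Some x"
    | y where "j \<in> free_cols i T r" "T (r, j) = Some y" "y \<in> {i, i + 1}" "x \<in> {i, i + 1}"
proof (cases "j \<in> free_cols i T r")
  case True
  then have "x \<in> {i, i + 1}" using assms by (simp add: BK_free split: if_splits)
  then show ?thesis using that(2) True free_colsD[OF True] by blast
qed (use assms that(1) in \<open>simp add: BK_not_free\<close>)

text \<open>Columns stay strict because a free square has no other \<open>i\<close> or
  \<open>i + 1\<close> in its column. In a row, rectangles keep every fixed \<open>i\<close> left
  and every fixed \<open>i + 1\<close> right of the free squares.\<close>

lemma semistandard_BK:
  assumes T: "semistandard T" and i: "1 \<le> i"
  shows "semistandard (BK i T)"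
  unfolding semistandard_def
proof (intro conjI allI impI)
  show "\<exists>\<kappa>. is_partition \<kappa> \<and> shape (BK i T) = young_diagram \<kappa>"
    using T by (simp add: semistandard_def shape_def dom_BK)
next
  fix s x assume x: "BK i T s = Some x"
  obtain r j where s: "s = (r, j)" by (cases s)
  show "1 \<le> x"
    using x unfolding s by (rule BK_cases) (use i semistandard_pos(3)[OF T] in auto)
next
  fix r r' j x y
  assume *: "r < r' \<and> BK i T (r, j) = Some x \<and> BK i T (r', j) = Some y"
  have lt: "u < w" if "T (r, j) = Some u" "T (r', j) = Some w" for u w
    using semistandard_col[OF T that] * by simp
  from * have 1: "BK i T (r, j) = Some x" and 2: "BK i T (r', j) = Some y" and rr: "r \<noteq> r'" by auto
  show "x < y"
  proof (cases rule: BK_cases[OF 1])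
    case x: 1
    show ?thesis
    proof (cases rule: BK_cases[OF 2])
      case 1
      then show ?thesis using lt x by simp
    next
      case (2 w)
      then have "x \<noteq> i" "x < w" using lt x rr by (auto simp: free_cols_def)
      then show ?thesis using 2 by auto
    qed
  next
    case x: (2 u)
    then have "j \<notin> free_cols i T r'" using free_cols_disjoint rr by blast
    then have y: "T (r', j) = Some y" using 2 by (simp add: BK_not_free)
    then have "u < y" "y \<noteq> i + 1" using lt x rr by (auto simp: free_cols_def)
    then show ?thesis using x by auto
  qed
next
  fix r j j' x y
  assume *: "j < j' \<and> BK i T (r, j) = Some x \<and> BK i T (r, j') = Some y"
  then have jj: "j < j'" and 1: "BK i T (r, j) = Some x" and 2: "BK i T (r, j') = Some y" by auto
  have le: "u \<le> w" if "T (r, j) = Some u" "T (r, j') = Some w" for u w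
    using semistandard_row[OF T that] jj by simp
  show "x \<le> y"
  proof (cases rule: BK_cases[OF 1])
    case x: 1
    show ?thesis
    proof (cases rule: BK_cases[OF 2])
      case 1
      then show ?thesis using le x by simp
    next
      case y: (2 w)
      have xw: "x \<le> w" using le x y by simp
      \<comment> \<open>A fixed \<open>i + 1\<close> sits below an \<open>i\<close>, which would
        force a second entry \<open>i\<close> or \<open>i + 1\<close> into the free column
        \<open>j'\<close>.\<close>
      have "x \<noteq> i + 1"
      proof
        assume xi: "x = i + 1"
        then obtain r' where r': "r' \<noteq> r" "T (r', j) \<in> {Some i, Some (i + 1)}"
          using x by (auto simp: free_cols_def)
        have "T (r', j) \<noteq> Some (i + 1)" using semistandard_col_unique[OF T] x(2) xi r'(1) by blast
        then have Ti: "T (r', j) = Some i" using r' by auto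
        then have "r' < r" using semistandard_col[OF T x(2) Ti] xi r'(1) by linarith
        then obtain z where "T (r', j') = Some z" "i \<le> z" "z < w"
          using semistandard_rectangle[OF T Ti y(2)] jj by (metis less_imp_le)
        then show False using y r'(1) by (auto simp: free_cols_def)
      qed
      then show ?thesis using xw y by auto
    qed
  next
    case x: (2 u)
    show ?thesis
    proof (cases rule: BK_cases[OF 2])
      case y: 1
      have uy: "u \<le> y" using le x y by simp
      \<comment> \<open>A fixed \<open>i\<close> sits above an \<open>i + 1\<close>, which would
        force an \<open>i + 1\<close> below the free square of column \<open>j\<close>.\<close>
      have "y \<noteq> i"
      proof
        assume yi: "y = i"
        then obtain r' where r': "r' \<noteq> r" "T (r', j') \<in> {Some i, Some (i + 1)}"
          using y by (auto simp: free_cols_def)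
        have "T (r', j') \<noteq> Some i" using semistandard_col_unique[OF T] y(2) yi r'(1) by blast
        then have Ti: "T (r', j') = Some (i + 1)" using r' by auto
        then have "r < r'" using semistandard_col[OF T Ti y(2)] yi r'(1) by linarith
        then obtain z where "T (r', j) = Some z" "u < z" "z \<le> i + 1"
          using semistandard_rectangle[OF T x(2) Ti] jj by (metis less_imp_le)
        then show False using x r'(1) by (auto simp: free_cols_def)
      qed
      then show ?thesis using uy x by auto
    next
      case y: (2 w)
      \<comment> \<open>Both squares are free: ranks grow to the right, so an \<open>i + 1\<close>
        is never followed by an \<open>i\<close>.\<close>
      have "card {k \<in> free_cols i T r. k < j} \<le> card {k \<in> free_cols i T r. k < j'}"
        using finite_free_cols[OF T] jj by (intro card_mono) auto
      then show ?thesis using 1 2 x(1) y(1) by (auto simp: BK_free split: if_splits)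
    qed
  qed
qed

section \<open>Column counts under the involution\<close>

lemma entry_cols_free_iff:
  assumes "j \<in> free_cols i T r" "v \<in> {i, i + 1}"
  shows "j \<in> entry_cols T v \<longleftrightarrow> T (r, j) = Some v"
  using assms unfolding entry_cols_def free_cols_def by auto

text \<open>If a column held only one of the two entries, the square of that entry would be
  free.\<close>

lemma entry_cols_not_free:
  assumes T: "semistandard T" and j: "\<And>r. j \<notin> free_cols i T r" and v: "v \<in> {i, i + 1}"
  shows "j \<in> entry_cols T v \<longleftrightarrow> j \<in> entry_cols T i"
proof -
  have "j \<in> entry_cols T w'" if w: "{w, w'} = {i, i + 1}" "j \<in> entry_cols T w" for w w'
  proof -
    obtain r where r: "T (r, j) = Some w" using w by (auto simp: entry_cols_def)
    have "w = i \<or> w = i + 1" using w(1) by blast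
    then obtain r' where r': "r' \<noteq> r" "T (r', j) = Some i \<or> T (r', j) = Some (i + 1)"
      using j[of r] r by (auto simp: free_cols_def)
    have "T (r', j) \<noteq> Some w" using semistandard_col_unique[OF T r, of r'] r'(1) by blast
    then have "T (r', j) = Some w'" using r' w(1) by (metis doubleton_eq_iff)
    then show ?thesis by (auto simp: entry_cols_def)
  qed
  then show ?thesis using v by (metis insert_commute insertE singletonD)
qed

lemma BK_entry_cols_not_free:
  assumes "\<And>r. j \<notin> free_cols i T r"
  shows "j \<in> entry_cols (BK i T) v \<longleftrightarrow> j \<in> entry_cols T v"
  using assms by (simp add: entry_cols_def BK_not_free)

text \<open>Columns without free squares contribute the same \<open>m\<close> for both entries and
  both tableaux, so later comparisons take place inside the free columns of single rows.\<close>

lemma BK_card_split: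
  assumes T: "semistandard T" and i: "1 \<le> i"
  obtains R m where "\<And>v. v \<in> {i, i + 1} \<Longrightarrow>
      card (entry_cols T v \<inter> S) = m + (\<Sum>r\<in>R. card (entry_cols T v \<inter> free_cols i T r \<inter> S))"
    "\<And>v. v \<in> {i, i + 1} \<Longrightarrow> card (entry_cols (BK i T) v \<inter> S) =
      m + (\<Sum>r\<in>R. card (entry_cols (BK i T) v \<inter> free_cols i T r \<inter> S))"
proof -
  let ?F = "free_cols i T"
  let ?U = "\<Union>r. ?F r"
  let ?R = "fst ` dom T"
  have fR: "finite ?R" using semistandard_finite[OF T] by simp
  have R: "?F r = {}" if "r \<notin> ?R" for r
  proof (rule ccontr)
    assume "?F r \<noteq> {}"
    then obtain j where "j \<in> ?F r" by blast
    from free_colsD[OF this] have "(r, j) \<in> dom T" by auto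
    then show False using that by force
  qed
  have disj: "?F r \<inter> ?F r' = {}" if "r \<noteq> r'" for r r' using that free_cols_disjoint by blast
  have split: "card (C \<inter> S) = card ((C - ?U) \<inter> S) + (\<Sum>r\<in>?R. card (C \<inter> ?F r \<inter> S))"
    if "finite C" for C
  proof -
    have "C \<inter> S - ?U = (C - ?U) \<inter> S" "\<And>r. C \<inter> S \<inter> ?F r = C \<inter> ?F r \<inter> S" by blast+
    then show ?thesis
      using card_split_family[of "C \<inter> S" ?R ?F, OF _ fR disj R] that by simp
  qed
  have eqT: "entry_cols T v - ?U = entry_cols T i - ?U" if "v \<in> {i, i + 1}" for v
  proof (intro set_eqI)
    fix j show "j \<in> entry_cols T v - ?U \<longleftrightarrow> j \<in> entry_cols T i - ?U"
    proof (cases "\<exists>r. j \<in> free_cols i T r")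
      case False
      then show ?thesis using entry_cols_not_free[OF T _ that, of j] by simp
    qed auto
  qed
  have eqBK: "entry_cols (BK i T) v - ?U = entry_cols T i - ?U" if "v \<in> {i, i + 1}" for v
  proof (intro set_eqI)
    fix j show "j \<in> entry_cols (BK i T) v - ?U \<longleftrightarrow> j \<in> entry_cols T i - ?U"
    proof (cases "\<exists>r. j \<in> free_cols i T r")
      case False
      then show ?thesis using entry_cols_not_free[OF T _ that, of j] BK_entry_cols_not_free[of j i T v] by simp
    qed auto
  qed
  show ?thesis
  proof (rule that)
    fix v assume v: "v \<in> {i, i + 1}"
    show "card (entry_cols T v \<inter> S) = card ((entry_cols T i - ?U) \<inter> S) +
        (\<Sum>r\<in>?R. card (entry_cols T v \<inter> ?F r \<inter> S))"
      using split[OF finite_entry_cols[OF T], of v] unfolding eqT[OF v] .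
    show "card (entry_cols (BK i T) v \<inter> S) = card ((entry_cols T i - ?U) \<inter> S) +
        (\<Sum>r\<in>?R. card (entry_cols (BK i T) v \<inter> ?F r \<inter> S))"
      using split[OF finite_entry_cols[OF semistandard_BK[OF T i]], of v] unfolding eqBK[OF v] .
  qed
qed

text \<open>\<open>BK i\<close> compares the rank of a free column with the number of old free
  \<open>i + 1\<close>s. \<open>card_rank_less\<close> gives the exchanged counts, monotonicity of
  the rank the two closure properties.\<close>

lemma BK_free_cols:
  fixes i :: nat
  assumes T: "semistandard T"
  defines "F \<equiv> free_cols i T"
  shows "card (entry_cols (BK i T) i \<inter> F r) = card (entry_cols T (i + 1) \<inter> F r)"
    and "card (entry_cols (BK i T) (i + 1) \<inter> F r) = card (entry_cols T i \<inter> F r)"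
    and "\<And>x y. x \<in> entry_cols (BK i T) i \<inter> F r \<Longrightarrow> y \<in> F r \<Longrightarrow> y \<le> x \<Longrightarrow>
      y \<in> entry_cols (BK i T) i \<inter> F r"
    and "\<And>x y. x \<in> entry_cols (BK i T) (i + 1) \<inter> F r \<Longrightarrow> y \<in> F r \<Longrightarrow> x \<le> y \<Longrightarrow>
      y \<in> entry_cols (BK i T) (i + 1) \<inter> F r"
proof -
  let ?c = "card {k \<in> F r. T (r, k) = Some (i + 1)}"
  let ?rk = "\<lambda>j. card {k \<in> F r. k < j}"
  have fin: "finite (F r)" unfolding F_def by (rule finite_free_cols[OF T])
  have BKF: "j \<in> free_cols i (BK i T) r" if "j \<in> F r" for j
    using that by (simp add: F_def free_cols_BK)
  have E1: "entry_cols (BK i T) i \<inter> F r = {j \<in> F r. ?rk j < ?c}"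
    using entry_cols_free_iff[OF BKF] BK_free[of _ i T r] unfolding F_def by (auto split: if_splits)
  have E2: "entry_cols (BK i T) (i + 1) \<inter> F r = F r - {j \<in> F r. ?rk j < ?c}"
    using entry_cols_free_iff[OF BKF] BK_free[of _ i T r] unfolding F_def by (auto split: if_splits)
  have T2: "entry_cols T (i + 1) \<inter> F r = {k \<in> F r. T (r, k) = Some (i + 1)}"
    using entry_cols_free_iff[of _ i T r "i + 1"] unfolding F_def by auto
  have T1: "entry_cols T i \<inter> F r = F r - {k \<in> F r. T (r, k) = Some (i + 1)}"
    using entry_cols_free_iff[of _ i T r i] free_colsD[of _ i T r] unfolding F_def by auto
  have c: "card {j \<in> F r. ?rk j < ?c} = ?c"
    using fin by (intro card_rank_less card_mono) auto
  show "card (entry_cols (BK i T) i \<inter> F r) = card (entry_cols T (i + 1) \<inter> F r)"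
    unfolding E1 T2 by (rule c)
  show "card (entry_cols (BK i T) (i + 1) \<inter> F r) = card (entry_cols T i \<inter> F r)"
    unfolding E2 T1 using fin c by (simp add: card_Diff_subset)
  have mono: "?rk x \<le> ?rk y" if "x \<le> y" for x y
    using fin that by (intro card_mono) auto
  show "y \<in> entry_cols (BK i T) i \<inter> F r"
    if "x \<in> entry_cols (BK i T) i \<inter> F r" "y \<in> F r" "y \<le> x" for x y
    using that mono[OF that(3)] unfolding E1 by auto
  show "y \<in> entry_cols (BK i T) (i + 1) \<inter> F r"
    if "x \<in> entry_cols (BK i T) (i + 1) \<inter> F r" "y \<in> F r" "x \<le> y" for x y
    using that mono[OF that(3)] unfolding E2 by auto
qed

text \<open>In each row the new \<open>i + 1\<close>s form a final segment of the free columns, as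
  large as the set of old free \<open>i\<close>s, so \<open>card_upper_set_ge\<close> applies at
  every \<open>c\<close>, cut or not.\<close>

lemma BK_card_upper:
  assumes T: "semistandard T" and i: "1 \<le> i"
  shows "card (entry_cols T i \<inter> {c..}) \<le> card (entry_cols (BK i T) (i + 1) \<inter> {c..})"
proof -
  obtain R m where S: "\<And>v. v \<in> {i, i + 1} \<Longrightarrow> card (entry_cols T v \<inter> {c..}) =
      m + (\<Sum>r\<in>R. card (entry_cols T v \<inter> free_cols i T r \<inter> {c..}))"
    "\<And>v. v \<in> {i, i + 1} \<Longrightarrow> card (entry_cols (BK i T) v \<inter> {c..}) =
      m + (\<Sum>r\<in>R. card (entry_cols (BK i T) v \<inter> free_cols i T r \<inter> {c..}))"
    by (rule BK_card_split[OF T i, of "{c..}"]) (rule that)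
  have "card (entry_cols T i \<inter> free_cols i T r \<inter> {c..})
      \<le> card (entry_cols (BK i T) (i + 1) \<inter> free_cols i T r \<inter> {c..})" for r
    by (rule card_upper_set_ge[OF finite_free_cols[OF T] _ _ BK_free_cols(2)[OF T]])
      (use BK_free_cols(4)[OF T] in blast)+
  then show ?thesis using S by (simp add: sum_mono)
qed

lemma BK_card_lower:
  assumes T: "semistandard T" and i: "1 \<le> i"
  shows "card (entry_cols T (i + 1) \<inter> {..<c}) \<le> card (entry_cols (BK i T) i \<inter> {..<c})"
proof -
  obtain R m where S: "\<And>v. v \<in> {i, i + 1} \<Longrightarrow> card (entry_cols T v \<inter> {..<c}) =
      m + (\<Sum>r\<in>R. card (entry_cols T v \<inter> free_cols i T r \<inter> {..<c}))"
    "\<And>v. v \<in> {i, i + 1} \<Longrightarrow> card (entry_cols (BK i T) v \<inter> {..<c}) =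
      m + (\<Sum>r\<in>R. card (entry_cols (BK i T) v \<inter> free_cols i T r \<inter> {..<c}))"
    by (rule BK_card_split[OF T i, of "{..<c}"]) (rule that)
  have "card (entry_cols T (i + 1) \<inter> free_cols i T r \<inter> {..<c})
      \<le> card (entry_cols (BK i T) i \<inter> free_cols i T r \<inter> {..<c})" for r
    by (rule card_lower_set_ge[OF finite_free_cols[OF T] _ _ BK_free_cols(1)[OF T]])
      (use BK_free_cols(3)[OF T] in blast)+
  then show ?thesis using S by (simp add: sum_mono)
qed

text \<open>\<open>S\<close> is meant to be one side of a cut, or everything: a row has all or none
  of its free columns in \<open>S\<close>, so only the exchanged totals per row count.\<close>

lemma BK_card_eq:
  assumes T: "semistandard T" and i: "1 \<le> i"
    and S: "\<And>r. free_cols i T r \<subseteq> S \<or> free_cols i T r \<inter> S = {}"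
  shows "card (entry_cols (BK i T) i \<inter> S) = card (entry_cols T (i + 1) \<inter> S)"
    and "card (entry_cols (BK i T) (i + 1) \<inter> S) = card (entry_cols T i \<inter> S)"
proof -
  obtain R m where split: "\<And>v. v \<in> {i, i + 1} \<Longrightarrow> card (entry_cols T v \<inter> S) =
      m + (\<Sum>r\<in>R. card (entry_cols T v \<inter> free_cols i T r \<inter> S))"
    "\<And>v. v \<in> {i, i + 1} \<Longrightarrow> card (entry_cols (BK i T) v \<inter> S) =
      m + (\<Sum>r\<in>R. card (entry_cols (BK i T) v \<inter> free_cols i T r \<inter> S))"
    by (rule BK_card_split[OF T i, of S]) (rule that)
  have *: "card (A \<inter> free_cols i T r \<inter> S) = card (B \<inter> free_cols i T r \<inter> S)"
    if "card (A \<inter> free_cols i T r) = card (B \<inter> free_cols i T r)" for A B r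
  proof -
    have "(\<forall>A. A \<inter> free_cols i T r \<inter> S = A \<inter> free_cols i T r) \<or> (\<forall>A. A \<inter> free_cols i T r \<inter> S = {})"
      using S[of r] by blast
    then show ?thesis using that by auto
  qed
  show "card (entry_cols (BK i T) i \<inter> S) = card (entry_cols T (i + 1) \<inter> S)"
    using split *[OF BK_free_cols(1)[OF T]] by simp
  show "card (entry_cols (BK i T) (i + 1) \<inter> S) = card (entry_cols T i \<inter> S)"
    using split *[OF BK_free_cols(2)[OF T]] by simp
qed

section \<open>Locality of the involutions and their odd composite\<close>

lemma free_cols_same: "same_entries i T S \<Longrightarrow> free_cols i T r = free_cols i S r"
  by (simp add: same_entries_def free_cols_def)

lemma is_cut_same: "same_entries i T S \<Longrightarrow> is_cut i T c \<longleftrightarrow> is_cut i S c"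
  by (simp add: is_cut_def free_cols_same)

lemma entry_cols_same:
  "same_entries i T S \<Longrightarrow> entry_cols T i = entry_cols S i \<and> entry_cols T (i + 1) = entry_cols S (i + 1)"
  by (simp add: same_entries_def entry_cols_def)

lemma same_entries_trans: "same_entries i T S \<Longrightarrow> same_entries i S R \<Longrightarrow> same_entries i T R"
  by (simp add: same_entries_def)

lemma BK_same:
  assumes "same_entries i T S"
  shows "same_entries i (BK i T) (BK i S)"
proof -
  have "BK i T (r, j) = Some v \<longleftrightarrow> BK i S (r, j) = Some v" if "v \<in> {i, i + 1}" for r j v
  proof (cases "j \<in> free_cols i T r")
    case True
    then show ?thesis
      using assms by (simp add: BK_free free_cols_same[OF assms, symmetric] same_entries_def)
  next
    case False
    then show ?thesis
      using assms that by (auto simp: BK_not_free free_cols_same[OF assms] same_entries_def)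
  qed
  then show ?thesis by (simp add: same_entries_def)
qed

lemma BK_far: "{v, v + 1} \<inter> {w, w + 1} = {} \<Longrightarrow> same_entries v (BK w T) T"
  unfolding same_entries_def using BK_other[of _ w T] by blast

text \<open>Distinct odd indices act on disjoint pairs of values, so on \<open>v\<close> and
  \<open>v + 1\<close> only a factor \<open>BK v\<close> is visible, whatever its place in the
  list.\<close>

lemma foldr_BK_same:
  assumes "distinct vs" "\<And>w. w \<in> set vs \<Longrightarrow> odd w" "odd v"
  shows "same_entries v (foldr BK vs T) (if v \<in> set vs then BK v T else T)"
  using assms
proof (induction vs)
  case Nil
  then show ?case by (simp add: same_entries_def)
next
  case (Cons w ws)
  then have IH: "same_entries v (foldr BK ws T) (if v \<in> set ws then BK v T else T)" by simp
  show ?case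
  proof (cases "v = w")
    case True
    then show ?thesis using BK_same[OF IH] Cons.prems(1) by simp
  next
    case False
    have "odd w" using Cons.prems by simp
    then have "{v, v + 1} \<inter> {w, w + 1} = {}" using False \<open>odd v\<close> by (auto elim!: oddE)
    then show ?thesis using BK_far same_entries_trans[OF _ IH] False by simp
  qed
qed

lemma semistandard_foldr_BK:
  "semistandard T \<Longrightarrow> \<forall>v\<in>set vs. 1 \<le> v \<Longrightarrow>
    semistandard (foldr BK vs T) \<and> dom (foldr BK vs T) = dom T"
  by (induction vs) (auto simp: semistandard_BK dom_BK)

section \<open>Exchange of matchings between neighbouring values\<close>

text \<open>At a cut of one of the two involutions, one summand of \<open>cut_count\<close> equals
  its old value, while the other can only grow.\<close>

lemma matching_swap:
  assumes T: "semistandard T" and T': "semistandard T'" and v: "1 \<le> v"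
    and same: "same_entries v T' (BK v T)" "same_entries (v + 2) T' (BK (v + 2) T)"
  shows "has_matching T v a \<Longrightarrow> has_matching T' (v + 1) a"
    and "has_matching T (v + 1) a \<Longrightarrow> has_matching T' v a"
proof -
  have E: "entry_cols T' v = entry_cols (BK v T) v"
    "entry_cols T' (v + 1) = entry_cols (BK v T) (v + 1)"
    "entry_cols T' (v + 2) = entry_cols (BK (v + 2) T) (v + 2)"
    "entry_cols T' (v + 3) = entry_cols (BK (v + 2) T) (v + 2 + 1)"
    using entry_cols_same[OF same(1)] entry_cols_same[OF same(2)] by (simp_all add: eval_nat_numeral)
  \<comment> \<open>Freeness survives \<open>BK\<close>, so a cut found in \<open>T'\<close> is also
    one in \<open>T\<close>.\<close>
  have cut: "is_cut v T' c \<longleftrightarrow> is_cut v T c" "is_cut (v + 2) T' c \<longleftrightarrow> is_cut (v + 2) T c" for c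
    using is_cut_same[OF same(1)] is_cut_same[OF same(2)] by (auto simp: is_cut_def free_cols_BK)
  have v2: "1 \<le> v + 2" by simp
  show "has_matching T' (v + 1) a" if M: "has_matching T v a"
  proof (rule cut_count_imp_has_matching[OF T'])
    fix c
    \<comment> \<open>A cut for \<open>v + 2\<close>: left of \<open>c'\<close> the number of
      \<open>v + 3\<close>s must equal the old number of \<open>v + 2\<close>s. From
      \<open>c'\<close> on, \<open>BK_card_upper\<close> compares \<open>v + 1\<close> with the old
      \<open>v\<close>.\<close>
    obtain c' where c': "is_cut (v + 2) T' c'"
      "cut_count (entry_cols T' (v + 1)) (entry_cols T' (v + 3)) c'
        \<le> cut_count (entry_cols T' (v + 1)) (entry_cols T' (v + 3)) c"
      using upper_cut[OF T'] by blast
    have "free_cols (v + 2) T r \<subseteq> {..<c'} \<or> free_cols (v + 2) T r \<inter> {..<c'} = {}" for r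
      using c'(1)[unfolded cut] unfolding is_cut_def by (fastforce simp: disjoint_iff dest: spec[of _ r])
    note eq = BK_card_eq(2)[OF T v2 this]
    have "a \<le> cut_count (entry_cols T v) (entry_cols T (v + 2)) c'"
      by (rule has_matching_imp_cut_count[OF T M])
    also have "\<dots> \<le> cut_count (entry_cols T' (v + 1)) (entry_cols T' (v + 3)) c'"
      unfolding cut_count_def E eq using BK_card_upper[OF T v] by simp
    also note c'(2)
    finally show "a \<le> cut_count (entry_cols T' (v + 1)) (entry_cols T' (v + 1 + 2)) c"
      by (simp add: eval_nat_numeral)
  qed
  show "has_matching T' v a" if M: "has_matching T (v + 1) a"
  proof (rule cut_count_imp_has_matching[OF T'])
    fix c
    \<comment> \<open>A cut for \<open>v\<close>: from \<open>c'\<close> on the number of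
      \<open>v\<close>s must equal the old number of \<open>v + 1\<close>s. Left of
      \<open>c'\<close>, \<open>BK_card_lower\<close> compares \<open>v + 2\<close> with the old
      \<open>v + 3\<close>.\<close>
    obtain c' where c': "is_cut v T' c'"
      "cut_count (entry_cols T' v) (entry_cols T' (v + 2)) c'
        \<le> cut_count (entry_cols T' v) (entry_cols T' (v + 2)) c"
      using lower_cut[OF T'] by blast
    have "free_cols v T r \<subseteq> {c'..} \<or> free_cols v T r \<inter> {c'..} = {}" for r
      using c'(1)[unfolded cut] unfolding is_cut_def by (fastforce simp: disjoint_iff dest: spec[of _ r])
    note eq = BK_card_eq(1)[OF T v this]
    have "a \<le> cut_count (entry_cols T (v + 1)) (entry_cols T (v + 2 + 1)) c'"
      using has_matching_imp_cut_count[OF T M] by (simp add: eval_nat_numeral)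
    also have "\<dots> \<le> cut_count (entry_cols T' v) (entry_cols T' (v + 2)) c'"
      unfolding cut_count_def E eq using BK_card_lower[OF T v2] by simp
    also note c'(2)
    finally show "a \<le> cut_count (entry_cols T' v) (entry_cols T' (v + 2)) c" .
  qed
qed

section \<open>Shuffle diagrams\<close>

lemma skew_diagram_pos: "(i, j) \<in> skew_diagram \<alpha> \<beta> \<Longrightarrow> 1 \<le> i \<and> 1 \<le> j \<and> i \<le> length \<alpha>"
  by (auto simp: skew_diagram_def young_diagram_def)

lemma shuffle_diagram_odd_row:
  "{c. (2 * k + 1, c) \<in> shuffle_diagram \<alpha> \<beta> \<gamma> \<delta>} =
    (\<lambda>j. 2 * j - 1) ` {j. (k + 1, j) \<in> skew_diagram \<alpha> \<beta>}"
proof (intro set_eqI iffI)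
  fix c assume "c \<in> {c. (2 * k + 1, c) \<in> shuffle_diagram \<alpha> \<beta> \<gamma> \<delta>}"
  moreover have "2 * k + 1 \<noteq> 2 * i" for i by presburger
  ultimately obtain i j where ij: "2 * k + 1 = 2 * i - 1" "c = 2 * j - 1" "(i, j) \<in> skew_diagram \<alpha> \<beta>"
    unfolding shuffle_diagram_def by blast
  have "i = k + 1" using ij(1) skew_diagram_pos[OF ij(3)] by linarith
  then show "c \<in> (\<lambda>j. 2 * j - 1) ` {j. (k + 1, j) \<in> skew_diagram \<alpha> \<beta>}" using ij by blast
next
  fix c assume "c \<in> (\<lambda>j. 2 * j - 1) ` {j. (k + 1, j) \<in> skew_diagram \<alpha> \<beta>}"
  then have "(2 * (k + 1) - 1, c) \<in> shuffle_diagram \<alpha> \<beta> \<gamma> \<delta>"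
    unfolding shuffle_diagram_def by blast
  then show "c \<in> {c. (2 * k + 1, c) \<in> shuffle_diagram \<alpha> \<beta> \<gamma> \<delta>}" by simp
qed

lemma shuffle_diagram_even_row:
  "{c. (2 * k + 2, c) \<in> shuffle_diagram \<alpha> \<beta> \<gamma> \<delta>} =
    (\<lambda>j. 2 * j) ` {j. (k + 1, j) \<in> skew_diagram \<gamma> \<delta>}"
proof (intro set_eqI iffI)
  fix c assume "c \<in> {c. (2 * k + 2, c) \<in> shuffle_diagram \<alpha> \<beta> \<gamma> \<delta>}"
  moreover have "2 * k + 2 \<noteq> 2 * i - 1" if "(i, j) \<in> skew_diagram \<alpha> \<beta>" for i j
    using skew_diagram_pos[OF that] by presburger
  ultimately obtain i j where ij: "2 * k + 2 = 2 * i" "c = 2 * j" "(i, j) \<in> skew_diagram \<gamma> \<delta>"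
    unfolding shuffle_diagram_def by blast
  have "i = k + 1" using ij(1) by linarith
  then show "c \<in> (\<lambda>j. 2 * j) ` {j. (k + 1, j) \<in> skew_diagram \<gamma> \<delta>}" using ij by blast
next
  fix c assume "c \<in> (\<lambda>j. 2 * j) ` {j. (k + 1, j) \<in> skew_diagram \<gamma> \<delta>}"
  then have "(2 * (k + 1), c) \<in> shuffle_diagram \<alpha> \<beta> \<gamma> \<delta>"
    unfolding shuffle_diagram_def by blast
  then show "c \<in> {c. (2 * k + 2, c) \<in> shuffle_diagram \<alpha> \<beta> \<gamma> \<delta>}" by simp
qed

lemma inj_on_double_pred: "inj_on (\<lambda>j::nat. 2 * j - 1) {1..}"
  by (auto simp: inj_on_def)

lemma card_shuffle_diagram_row:
  shows "card {c. (2 * k + 1, c) \<in> shuffle_diagram \<alpha> \<beta> \<gamma> \<delta>} = card {j. (k + 1, j) \<in> skew_diagram \<alpha> \<beta>}"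
    and "card {c. (2 * k + 2, c) \<in> shuffle_diagram \<alpha> \<beta> \<gamma> \<delta>} = card {j. (k + 1, j) \<in> skew_diagram \<gamma> \<delta>}"
proof -
  show "card {c. (2 * k + 1, c) \<in> shuffle_diagram \<alpha> \<beta> \<gamma> \<delta>} = card {j. (k + 1, j) \<in> skew_diagram \<alpha> \<beta>}"
    unfolding shuffle_diagram_odd_row
    by (intro card_image inj_on_subset[OF inj_on_double_pred]) (use skew_diagram_pos in auto)
  show "card {c. (2 * k + 2, c) \<in> shuffle_diagram \<alpha> \<beta> \<gamma> \<delta>} = card {j. (k + 1, j) \<in> skew_diagram \<gamma> \<delta>}"
    unfolding shuffle_diagram_even_row by (intro card_image) (auto simp: inj_on_def)
qed

text \<open>Rows \<open>r\<close> and \<open>r + 2\<close> have the same parity, so they come from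
  consecutive rows of one factor; the column maps are injective and preserve common columns.\<close>

lemma col_overlap_shuffle_diagram:
  shows "col_overlap (shuffle_diagram \<alpha> \<beta> \<gamma> \<delta>) (2 * k + 1) =
      card {j. (k + 1, j) \<in> skew_diagram \<alpha> \<beta> \<and> (k + 2, j) \<in> skew_diagram \<alpha> \<beta>}"
    and "col_overlap (shuffle_diagram \<alpha> \<beta> \<gamma> \<delta>) (2 * k + 2) =
      card {j. (k + 1, j) \<in> skew_diagram \<gamma> \<delta> \<and> (k + 2, j) \<in> skew_diagram \<gamma> \<delta>}"
proof -
  let ?D = "shuffle_diagram \<alpha> \<beta> \<gamma> \<delta>"
  have 1: "{c. (2 * k + 1, c) \<in> ?D \<and> (2 * k + 1 + 2, c) \<in> ?D} =
      (\<lambda>j. 2 * j - 1) ` {j. (k + 1, j) \<in> skew_diagram \<alpha> \<beta>} \<inter>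
      (\<lambda>j. 2 * j - 1) ` {j. (k + 2, j) \<in> skew_diagram \<alpha> \<beta>}"
    using shuffle_diagram_odd_row[of k \<alpha> \<beta> \<gamma> \<delta>] shuffle_diagram_odd_row[of "k + 1" \<alpha> \<beta> \<gamma> \<delta>]
    by (simp add: Collect_conj_eq eval_nat_numeral)
  also have "\<dots> = (\<lambda>j. 2 * j - 1) ` ({j. (k + 1, j) \<in> skew_diagram \<alpha> \<beta>} \<inter>
      {j. (k + 2, j) \<in> skew_diagram \<alpha> \<beta>})"
    by (rule inj_on_image_Int[OF inj_on_double_pred, symmetric]) (use skew_diagram_pos in auto)
  finally show "col_overlap ?D (2 * k + 1) =
      card {j. (k + 1, j) \<in> skew_diagram \<alpha> \<beta> \<and> (k + 2, j) \<in> skew_diagram \<alpha> \<beta>}"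
    unfolding col_overlap_def Collect_conj_eq
    by (simp only:) (intro card_image inj_on_subset[OF inj_on_double_pred], use skew_diagram_pos in auto)
  have inj: "inj ((*) (2::nat))" by (simp add: inj_on_def)
  have 2: "{c. (2 * k + 2, c) \<in> ?D \<and> (2 * k + 2 + 2, c) \<in> ?D} =
      (\<lambda>j. 2 * j) ` {j. (k + 1, j) \<in> skew_diagram \<gamma> \<delta>} \<inter>
      (\<lambda>j. 2 * j) ` {j. (k + 2, j) \<in> skew_diagram \<gamma> \<delta>}"
    using shuffle_diagram_even_row[of k \<alpha> \<beta> \<gamma> \<delta>] shuffle_diagram_even_row[of "k + 1" \<alpha> \<beta> \<gamma> \<delta>]
    by (simp add: Collect_conj_eq eval_nat_numeral)
  then show "col_overlap ?D (2 * k + 2) =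
      card {j. (k + 1, j) \<in> skew_diagram \<gamma> \<delta> \<and> (k + 2, j) \<in> skew_diagram \<gamma> \<delta>}"
    unfolding col_overlap_def Collect_conj_eq
    by (simp only: image_Int[OF inj, symmetric] card_image[OF inj_on_subset[OF inj subset_UNIV]])
qed

text \<open>Both sides are the overlap of the same two rows of \<open>\<gamma>/\<delta>\<close>.
  Renaming the shapes gives the other direction of the exchange.\<close>

lemma col_overlap_swap:
  "col_overlap (shuffle_diagram \<gamma> \<delta> \<alpha> \<beta>) (2 * k + 1) = col_overlap (shuffle_diagram \<alpha> \<beta> \<gamma> \<delta>) (2 * k + 2)"
  unfolding col_overlap_shuffle_diagram ..

lemma positive_nat_cases:
  assumes "1 \<le> (r::nat)"
  obtains k where "r = 2 * k + 1" | k where "r = 2 * k + 2"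
proof -
  have "r = 2 * ((r - 1) div 2) + 1 \<or> r = 2 * ((r - 1) div 2) + 2" using assms by presburger
  then show ?thesis using that by blast
qed

section \<open>Peelability of the image tableau\<close>

theorem theorem1p4:
  fixes lam mu nu rho :: "nat list" and l :: nat and T :: tableau
  assumes "length lam = l" and "length mu = l" and "length nu = l" and "length rho = l"
    and "is_skew_shape lam mu" and "is_skew_shape nu rho"
    and "peelable (shuffle_diagram lam mu nu rho) T"
  shows "peelable (shuffle_diagram nu rho lam mu) (BK_odd l T) \<and> shape (BK_odd l T) = shape T"
proof -
  let ?D = "shuffle_diagram lam mu nu rho" and ?D' = "shuffle_diagram nu rho lam mu"
  define vs where "vs = map (\<lambda>k. 2 * k - 1) [1..<l + 1]"
  define T' where "T' = BK_odd l T"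
  have T'_eq: "T' = foldr BK vs T" by (simp add: T'_def BK_odd_def vs_def)
  have T: "semistandard T"
    and content: "\<And>r. 1 \<le> r \<Longrightarrow> card (entry_cols T r) = card {c. (r, c) \<in> ?D}"
    and matching: "\<And>i. 1 \<le> i \<Longrightarrow> has_matching T i (col_overlap ?D i)"
    using assms(7) card_entries unfolding peelable_def has_matching_def by auto
  have vs: "v \<in> set vs \<longleftrightarrow> (\<exists>k<l. v = 2 * k + 1)" for v
  proof -
    have "v \<in> set vs \<longleftrightarrow> (\<exists>k. 1 \<le> k \<and> k \<le> l \<and> v = 2 * k - 1)" by (auto simp: vs_def)
    also have "\<dots> \<longleftrightarrow> (\<exists>k<l. v = 2 * k + 1)" by presburger
    finally show ?thesis .
  qed
  have "distinct vs" by (auto simp: vs_def distinct_map inj_on_def)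
  then have same: "same_entries (2 * k + 1) T' (if k < l then BK (2 * k + 1) T else T)" for k
    using foldr_BK_same[of vs "2 * k + 1" T] vs unfolding T'_eq by fastforce
  have "\<forall>v\<in>set vs. 1 \<le> v" using vs by auto
  then have T': "semistandard T'" and dom: "dom T' = dom T"
    using semistandard_foldr_BK[OF T] unfolding T'_eq by blast+
  have big: "card {j. (k + 1, j) \<in> skew_diagram \<alpha> \<beta>} = 0" if "length \<alpha> \<le> k" for \<alpha> \<beta> k
    using skew_diagram_pos[of "k + 1" _ \<alpha> \<beta>] that by fastforce
  have content': "card (entry_cols T' (2 * k + 1)) = card (entry_cols T (2 * k + 2))"
    "card (entry_cols T' (2 * k + 2)) = card (entry_cols T (2 * k + 1))" for k
  proof -
    have "card (entry_cols T' (2 * k + 1)) = card (entry_cols T (2 * k + 2)) \<and>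
      card (entry_cols T' (2 * k + 2)) = card (entry_cols T (2 * k + 1))"
    \<comment> \<open>With \<open>S = UNIV\<close>, \<open>BK_card_eq\<close> exchanges the totals;
      for \<open>k \<ge> l\<close> nothing acts on these two values, the rows are empty and all
      totals are 0.\<close>
    proof (cases "k < l")
      case True
      then show ?thesis
        using BK_card_eq[OF T, of "2 * k + 1" UNIV] entry_cols_same[OF same[of k]] by simp
    next
      case False
      then show ?thesis
        using entry_cols_same[OF same[of k]] content[of "2 * k + 1"] content[of "2 * k + 2"]
          card_shuffle_diagram_row[of k lam mu nu rho] big[of _ k] assms(1,3) by simp
    qed
    then show "card (entry_cols T' (2 * k + 1)) = card (entry_cols T (2 * k + 2))"
      "card (entry_cols T' (2 * k + 2)) = card (entry_cols T (2 * k + 1))" by auto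
  qed
  have "card {s. T' s = Some r} = card {c. (r, c) \<in> ?D'}" if "1 \<le> r" for r
    using that
  proof (cases r rule: positive_nat_cases)
    case (1 k)
    then show ?thesis
      unfolding card_entries[OF T'] using content'(1)[of k] content[of "2 * k + 2"]
      by (simp add: card_shuffle_diagram_row[simplified])
  next
    case (2 k)
    then show ?thesis
      unfolding card_entries[OF T'] using content'(2)[of k] content[of "2 * k + 1"]
      by (simp add: card_shuffle_diagram_row[simplified])
  qed
  moreover have "has_matching T' i (col_overlap ?D' i)" if i: "1 \<le> i" for i
  \<comment> \<open>The exchange needs both \<open>BK (2 * k + 1)\<close> and
    \<open>BK (2 * k + 3)\<close> as factors, that is \<open>k + 1 < l\<close>. Otherwise row
    \<open>k + 2\<close> of either shape is empty, the overlap is 0, and the empty matching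
    serves.\<close>
  proof (cases "\<exists>k. k + 1 < l \<and> (i = 2 * k + 1 \<or> i = 2 * k + 2)")
    case True
    then obtain k where k: "k + 1 < l" and ik: "i = 2 * k + 1 \<or> i = 2 * k + 2" by blast
    have "same_entries (2 * k + 1) T' (BK (2 * k + 1) T)"
      "same_entries (2 * k + 1 + 2) T' (BK (2 * k + 1 + 2) T)"
      using same[of k] same[of "k + 1"] k by (simp_all add: eval_nat_numeral)
    note swap = matching_swap[OF T T' _ this]
    show ?thesis
      using ik
    proof
      assume "i = 2 * k + 1"
      then show ?thesis
        using swap(2) matching[of "2 * k + 2"] by (simp add: col_overlap_swap[simplified])
    next
      assume "i = 2 * k + 2"
      then show ?thesis
        using swap(1) matching[of "2 * k + 1"] by (simp add: col_overlap_swap[simplified, of lam])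
    qed
  next
    case False
    have zero: "card {j. (k + 1, j) \<in> skew_diagram \<alpha> \<beta> \<and> (k + 2, j) \<in> skew_diagram \<alpha> \<beta>} = 0"
      if "\<not> k + 1 < l" "length \<alpha> = l" for k \<alpha> \<beta>
      using skew_diagram_pos[of "k + 2" _ \<alpha> \<beta>] that by fastforce
    have "col_overlap ?D' i = 0"
      using i
    proof (cases i rule: positive_nat_cases)
      case (1 k)
      then have "\<not> k + 1 < l" using False by blast
      then show ?thesis unfolding 1 col_overlap_shuffle_diagram using assms(3) by (rule zero)
    next
      case (2 k)
      then have "\<not> k + 1 < l" using False by blast
      then show ?thesis unfolding 2 col_overlap_shuffle_diagram using assms(1) by (rule zero)
    qed
    then show ?thesis unfolding has_matching_def by (intro exI[of _ "{}"]) simp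
  qed
  ultimately show ?thesis
    using T' dom unfolding T'_def[symmetric] peelable_def has_matching_def shape_def by blast
qed

end
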